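(* Let $1<p,q<\infty$. Let $\mu$ and $\lambda$ be two Borel probability measures without atoms on $G$ such that $(\mu,\lambda)$ is a packing pair, and let $\sigma=\mu\ast\lambda$. Then for any $g\in G$, the measure $\rho_g=\sigma+\delta_g\ast\mu$ does not admit any $(p,q)$-frame measure.
   Context: $G$ is a locally compact Hausdorff abelian (LCA) group, written additively, which is metrizable and a countable union of compact sets; $\widehat{G}$ is its dual group (continuous characters), and $\langle x,\gamma\rangle$ denotes the value of $\gamma\in\widehat{G}$ at $x\in G$. Measures are non-negative. A measure is without atoms if every point has measure zero. $\ast$ is convolution of measures and $\delta_g$ the Dirac measure at $g$. The closed support $K_\mu$ of a finite Borel measure $\mu$ on $G$ is the smallest closed set $K\subset G$ with $\mu(K)=\mu(G)$. The pair $(\mu,\lambda)$ is a packing pair if $(K_\mu-K_\mu)\cap(K_\lambda-K_\lambda)=\{0\}$, where $K-K=\{x-y:x,y\in K\}$. For a finite Borel measure $\rho$ on $G$ and $f\in L^1(\rho)$, $\widehat{fd\rho}(\gamma)=\int_G f(x)\overline{\langle x,\gamma\rangle}\,d\rho(x)$ for $\gamma\in\widehat{G}$. A Borel measure $\nu$ on $\widehat{G}$ is a $(p,q)$-frame measure for $\rho$ if there are constants $0<A\le B<\infty$ with $A\|f\|_{L^p(\rho)}^q\le\|\widehat{fd\rho}\|_{L^q(\nu)}^q\le B\|f\|_{L^p(\rho)}^q$ for all $f\in L^p(\rho)$; $\rho$ admits a $(p,q)$-frame measure if such a $\nu$ exists. *)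

theory Defs
  imports "HOL-Probability.Probability"
begin

definition dual_group :: "('a::topological_ab_group_add \<Rightarrow> complex) set" where
  "dual_group = {\<gamma>. continuous_on UNIV \<gamma> \<and> (\<forall>x. cmod (\<gamma> x) = 1) \<and>
                    (\<forall>x y. \<gamma> (x + y) = \<gamma> x * \<gamma> y)}"

text \<open>The dual group carries the compact-open topology. Its underlying set is all of
  \<^term>\<open>dual_group\<close>, since \<open>K = {}\<close> is allowed.\<close>

definition dual_topology :: "('a::topological_ab_group_add \<Rightarrow> complex) topology" where
  "dual_topology =
     topology_generated_by {{\<gamma> \<in> dual_group. \<gamma> ` K \<subseteq> U} | K U. compact K \<and> open U}"

definition dual_borel :: "('a::topological_ab_group_add \<Rightarrow> complex) measure" where
  "dual_borel = sigma dual_group {U. openin dual_topology U}"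

text \<open>The library constant \<^const>\<open>convolution\<close> is restricted to Euclidean spaces; the
  definition below is the same on a topological group. On a second countable group (in
  particular a metrizable, sigma-compact one) the Borel sets of the product are generated by
  Borel rectangles, so addition is measurable for the product measure.\<close>

definition conv_measure ::
    "'a::topological_ab_group_add measure \<Rightarrow> 'a measure \<Rightarrow> 'a measure" where
  "conv_measure M N = distr (M \<Otimes>\<^sub>M N) borel (\<lambda>(x, y). x + y)"

definition sum_measure :: "'a measure \<Rightarrow> 'a measure \<Rightarrow> 'a measure" where
  "sum_measure M N = measure_of (space M) (sets M) (\<lambda>A. emeasure M A + emeasure N A)"

definition without_atoms :: "'a measure \<Rightarrow> bool" where
  "without_atoms M \<longleftrightarrow> (\<forall>x. emeasure M {x} = 0)"

definition closed_support :: "'a::topological_space measure \<Rightarrow> 'a set" where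
  "closed_support M = (LEAST K. closed K \<and> emeasure M K = emeasure M (space M))"

definition difference_set :: "'a::ab_group_add set \<Rightarrow> 'a set" where
  "difference_set K = {x - y | x y. x \<in> K \<and> y \<in> K}"

definition packing_pair :: "'a::topological_ab_group_add measure \<Rightarrow> 'a measure \<Rightarrow> bool" where
  "packing_pair M N \<longleftrightarrow>
     difference_set (closed_support M) \<inter> difference_set (closed_support N) = {0}"

definition Lp_space :: "real \<Rightarrow> 'b measure \<Rightarrow> ('b \<Rightarrow> complex) set" where
  "Lp_space p M = {f \<in> borel_measurable M. integrable M (\<lambda>x. cmod (f x) powr p)}"

definition Lp_norm :: "real \<Rightarrow> 'b measure \<Rightarrow> ('b \<Rightarrow> complex) \<Rightarrow> real" where
  "Lp_norm p M f = (\<integral>x. cmod (f x) powr p \<partial>M) powr (1 / p)"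

definition fourier :: "'a measure \<Rightarrow> ('a \<Rightarrow> complex) \<Rightarrow> ('a \<Rightarrow> complex) \<Rightarrow> complex" where
  "fourier M f \<gamma> = (\<integral>x. f x * cnj (\<gamma> x) \<partial>M)"

text \<open>\<^const>\<open>Lp_norm\<close> is only meaningful on \<^const>\<open>Lp_space\<close>. Hence the membership clause,
  which is what finiteness of the \<open>L\<^sup>q(\<nu>)\<close>-norm in the upper frame bound amounts to. No
  finiteness or regularity is required of \<open>\<nu>\<close>.\<close>

definition frame_measure ::
    "real \<Rightarrow> real \<Rightarrow> 'a::topological_ab_group_add measure \<Rightarrow> ('a \<Rightarrow> complex) measure \<Rightarrow> bool" where
  "frame_measure p q M \<nu> \<longleftrightarrow>
     sets \<nu> = sets dual_borel \<and>
     (\<exists>A B::real. 0 < A \<and> A \<le> B \<and>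
        (\<forall>f \<in> Lp_space p M.
           fourier M f \<in> Lp_space q \<nu> \<and>
           A * Lp_norm p M f powr q \<le> Lp_norm q \<nu> (fourier M f) powr q \<and>
           Lp_norm q \<nu> (fourier M f) powr q \<le> B * Lp_norm p M f powr q))"

definition admits_frame_measure ::
    "real \<Rightarrow> real \<Rightarrow> 'a::topological_ab_group_add measure \<Rightarrow> bool" where
  "admits_frame_measure p q M \<longleftrightarrow> (\<exists>\<nu>. frame_measure p q M \<nu>)"

end

theory Submission
  imports Defs
begin

text \<open>Write \<open>\<sigma> = \<mu> * \<lambda>\<close>, \<open>\<tau> = \<delta>\<^sub>g * \<mu>\<close>. As \<open>\<lambda>\<close> has no atoms, packing forces
  \<open>\<sigma>(g + K\<^sub>\<mu>) = 0\<close>, so test functions can be chosen that see only \<open>\<sigma>\<close> or only \<open>\<tau>\<close>.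
  For compact \<open>C \<subseteq> K\<^sub>\<mu>\<close> and \<open>E \<subseteq> K\<^sub>\<lambda>\<close>, let \<open>f\<close> and \<open>h\<close> be the indicators of
  the part of \<open>C + E\<close> outside \<open>g + K\<^sub>\<mu>\<close> and of \<open>g + C\<close>. By packing, the transform of \<open>f\<close> is the
  product of those of \<open>1\<^sub>C d\<mu>\<close> and \<open>1\<^sub>E d\<lambda>\<close>, while the transform of \<open>h\<close> is that of
  \<open>1\<^sub>C d\<mu>\<close> up to a unimodular factor. Bounding the factor of \<open>1\<^sub>E d\<lambda>\<close> by \<open>\<lambda>(E)\<close>, the lower
  frame bound for \<open>f\<close> and the upper one for \<open>h\<close> give
  \<open>A (\<mu>(C) \<lambda>(E))\<^bsup>q/p\<^esup> \<le> \<lambda>(E)\<^bsup>q\<^esup> B \<mu>(C)\<^bsup>q/p\<^esup>\<close>, that is \<open>A/B \<le> \<lambda>(E)\<^bsup>q - q/p\<^esup>\<close>, which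
  fails when \<open>\<lambda>(E)\<close> is small, since \<open>p > 1\<close>.\<close>

section \<open>Countable bases from metrizability and sigma-compactness\<close>

lemma Lindelof_space_sigma_compact:
  fixes \<K> :: "'a::topological_space set set"
  assumes "countable \<K>" "\<And>K. K \<in> \<K> \<Longrightarrow> compact K" "\<Union>\<K> = UNIV"
  shows "Lindelof_space (euclidean :: 'a topology)"
proof -
  have "Lindelof_space (subtopology euclidean (\<Union>\<K>))"
  proof (rule Lindelof_space_Union)
    show "Lindelof_space (subtopology euclidean K)" if "K \<in> \<K>" for K
      using assms(2)[OF that]
      by (intro compact_imp_Lindelof_space compact_space_subtopology) (simp add: compactin_euclidean_iff)
  qed (simp add: assms(1))
  then show ?thesis by (simp add: assms)
qed

text \<open>For each \<open>n\<close>, the Lindelof property leaves countably many balls of radius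
  \<open>1 / (n + 1)\<close> covering the space; collected over all \<open>n\<close> they form a
  base.\<close>

lemma metrizable_Lindelof_imp_second_countable:
  assumes "metrizable_space X" "Lindelof_space X"
  shows "second_countable X"
proof -
  obtain M d where Md: "Metric_space M d" and X: "X = Metric_space.mtopology M d"
    using assms(1) by (auto simp: metrizable_space_def)
  interpret Metric_space M d by (rule Md)
  have "\<exists>\<V>. countable \<V> \<and> \<V> \<subseteq> (\<lambda>x. mball x (inverse (real (Suc n)))) ` M \<and> \<Union>\<V> = M" for n
    using Lindelof_spaceD[OF assms(2), of "(\<lambda>x. mball x (inverse (real (Suc n)))) ` M"]
    by (fastforce simp: X simp del: of_nat_Suc)
  then obtain \<V> where \<V>: "\<And>n. countable (\<V> n)"
      "\<And>n. \<V> n \<subseteq> (\<lambda>x. mball x (inverse (real (Suc n)))) ` M" "\<And>n. \<Union>(\<V> n) = M"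
    by metis
  show ?thesis
    unfolding second_countable_def
  proof (intro exI conjI ballI allI impI)
    show "countable (\<Union>n. \<V> n)" using \<V>(1) by auto
    show "openin X V" if "V \<in> (\<Union>n. \<V> n)" for V
      using that \<V>(2) by (force simp: X)
    fix U x assume Ux: "openin X U \<and> x \<in> U"
    then obtain r where r: "r > 0" "mball x r \<subseteq> U" and xM: "x \<in> M"
      unfolding X openin_mtopology by blast
    \<comment> \<open>Half of \<open>r\<close>, because \<open>V\<close> will be a ball about
      another centre \<open>z\<close>: each of its points lies within two radii of
      \<open>x\<close>.\<close>
    obtain n where n: "inverse (real (Suc n)) < r / 2"
      using reals_Archimedean[of "r/2"] r by auto
    obtain V where V: "V \<in> \<V> n" "x \<in> V" using \<V>(3)[of n] xM by blast
    then obtain z where z: "z \<in> M" "V = mball z (inverse (real (Suc n)))" using \<V>(2) by blast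
    have "V \<subseteq> mball x r"
    proof
      fix y assume "y \<in> V"
      with z V n triangle[of x z y] show "y \<in> mball x r"
        by (auto simp: commute simp del: of_nat_Suc)
    qed
    with V r show "\<exists>V\<in>\<Union>n. \<V> n. x \<in> V \<and> V \<subseteq> U" by blast
  qed
qed

lemma second_countable_imp_countable_basis:
  assumes "second_countable (euclidean :: 'a::topological_space topology)"
  obtains B :: "'a::topological_space set set" where "countable B" "topological_basis B"
proof -
  obtain B :: "'a set set" where B: "countable B" "\<And>V. V \<in> B \<Longrightarrow> open V"
      "\<And>U x. open U \<Longrightarrow> x \<in> U \<Longrightarrow> \<exists>V\<in>B. x \<in> V \<and> V \<subseteq> U"
    using assms unfolding second_countable_def open_openin[symmetric] by metis
  then have "topological_basis B" by (intro topological_basisI)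
  with B(1) show ?thesis by (rule that)
qed

text \<open>An open preimage is a countable union of products of basic open sets, hence lies in the
  product sigma-algebra. Second countability is a hypothesis on the topology because the theorem
  derives it instead of fixing a type class.\<close>

lemma measurable_pair_continuous:
  fixes f :: "'a::topological_space \<times> 'b::topological_space \<Rightarrow> 'c::topological_space"
  assumes "second_countable (euclidean :: 'a topology)" "second_countable (euclidean :: 'b topology)"
    and f: "continuous_on UNIV f"
  shows "f \<in> borel_measurable (borel \<Otimes>\<^sub>M borel)"
proof (rule borel_measurableI)
  fix U :: "'c set" assume "open U"
  then have op: "open (f -` U)" using f by (simp add: open_vimage)
  obtain A :: "'a set set" where A: "countable A" "topological_basis A"
    using second_countable_imp_countable_basis assms(1) by blast
  obtain B :: "'b set set" where B: "countable B" "topological_basis B"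
    using second_countable_imp_countable_basis assms(2) by blast
  obtain \<R> where \<R>: "\<R> \<subseteq> (\<lambda>(a, b). a \<times> b) ` (A \<times> B)" "f -` U = \<Union>\<R>"
    using topological_basis_prod[OF A(2) B(2)] op unfolding topological_basis_def by metis
  have "countable \<R>" by (rule countable_subset[OF \<R>(1)]) (simp add: A(1) B(1))
  moreover have "R \<in> sets (borel \<Otimes>\<^sub>M borel)" if "R \<in> \<R>" for R
    using that \<R>(1) topological_basis_open[OF A(2)] topological_basis_open[OF B(2)]
    by (force intro!: pair_measureI)
  ultimately have "f -` U \<in> sets (borel \<Otimes>\<^sub>M borel)"
    unfolding \<R>(2) by (intro sets.countable_Union) auto
  then show "f -` U \<inter> space (borel \<Otimes>\<^sub>M borel) \<in> sets (borel \<Otimes>\<^sub>M borel)"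
    by (simp add: space_pair_measure)
qed

section \<open>Closed supports and sets of small positive measure\<close>

text \<open>A countable base makes the union of all null basic open sets null. Its complement is
  therefore the least closed set of full measure, so the \<open>LEAST\<close> in the definition is
  attained.\<close>

lemma closed_support:
  fixes M :: "'a::topological_space measure"
  assumes "second_countable (euclidean :: 'a topology)" "sets M = sets borel" "finite_measure M"
  shows closed_closed_support: "closed (closed_support M)"
    and AE_closed_support: "AE x in M. x \<in> closed_support M"
proof -
  interpret finite_measure M by fact
  have sp: "space M = UNIV" using sets_eq_imp_space_eq[OF assms(2)] by simp
  obtain B :: "'a set set" where B: "countable B" "topological_basis B"
    using second_countable_imp_countable_basis assms(1) by blast
  define K where "K = - \<Union>{V\<in>B. emeasure M V = 0}"
  have Bo: "V \<in> B \<Longrightarrow> open V" for V using topological_basis_open[OF B(2)] .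
  have full: "emeasure M S = emeasure M (space M) \<longleftrightarrow> - S \<in> null_sets M" if "closed S" for S
  proof -
    have S: "S \<in> sets M" using that assms(2) by simp
    have "measure M (- S) = measure M (space M) - measure M S"
      using finite_measure_compl[OF S] by (simp add: sp Compl_eq_Diff_UNIV)
    moreover have "- S \<in> sets M" using sets.compl_sets[OF S] by (simp add: sp Compl_eq_Diff_UNIV)
    ultimately show ?thesis by (auto simp: null_sets_def emeasure_eq_measure)
  qed
  have clK: "closed K" unfolding K_def using Bo by (auto simp: closed_def)
  have "(\<Union>V\<in>{V\<in>B. emeasure M V = 0}. V) \<in> null_sets M"
    using B(1) Bo assms(2) by (intro null_sets_UN') (auto simp: null_sets_def)
  then have null: "- K \<in> null_sets M" by (simp add: K_def)
  have "K \<subseteq> S" if "closed S" "emeasure M S = emeasure M (space M)" for S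
  proof -
    have S: "- S \<in> null_sets M" using that full by simp
    have "open (- S)" using that(1) by (rule open_Compl)
    then obtain B' where B': "B' \<subseteq> B" "\<Union>B' = - S"
      using B(2) unfolding topological_basis_def by blast
    have "emeasure M V = 0" if "V \<in> B'" for V
    proof -
      have "V \<subseteq> - S" using B'(2) that by blast
      then show ?thesis using emeasure_mono[of V "- S" M] S by (auto simp: null_sets_def)
    qed
    then have "- S \<subseteq> - K" using B' unfolding K_def by blast
    then show ?thesis by blast
  qed
  then have eq: "closed_support M = K"
    unfolding closed_support_def using clK null full[OF clK] by (intro Least_equality) auto
  show "closed (closed_support M)" by (simp add: eq clK)
  show "AE x in M. x \<in> closed_support M"
    using AE_not_in[OF null] by (simp add: eq)
qed

text \<open>Finite intersections of basic neighbourhoods of \<open>x\<close> have closures that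
  decrease to \<open>{x}\<close> by the Hausdorff property; continuity from above and the absence of
  atoms do the rest.\<close>

lemma small_neighbourhood:
  fixes M :: "'a::t2_space measure" and e :: real
  assumes "second_countable (euclidean :: 'a topology)" "sets M = sets borel" "finite_measure M"
    and "without_atoms M" "e > 0"
  obtains U where "open U" "x \<in> U" "measure M (closure U) < e"
proof -
  interpret finite_measure M by fact
  obtain B :: "'a set set" where B: "countable B" "topological_basis B"
    using second_countable_imp_countable_basis assms(1) by blast
  define N where "N = {V\<in>B. x \<in> V}"
  have "N \<noteq> {}" unfolding N_def using topological_basisE[OF B(2) open_UNIV, of x] by blast
  define A where "A n = (\<Inter>i\<le>n. from_nat_into N i)" for n :: nat
  have fN: "from_nat_into N i \<in> N" for i using from_nat_into[OF \<open>N \<noteq> {}\<close>] .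
  have "(\<Inter>n. closure (A n)) = {x}"
  proof (intro equalityI subsetI)
    fix y assume y: "y \<in> (\<Inter>n. closure (A n))"
    show "y \<in> {x}"
    proof (rule ccontr)
      assume "y \<notin> {x}"
      then obtain U V where UV: "open U" "open V" "x \<in> U" "y \<in> V" "U \<inter> V = {}"
        using hausdorff[of x y] by auto
      obtain W where W: "W \<in> B" "x \<in> W" "W \<subseteq> U" using topological_basisE[OF B(2) UV(1,3)] .
      then obtain i where "W = from_nat_into N i"
        using from_nat_into_surj[of N W] B(1) unfolding N_def by auto
      then have "A i \<subseteq> U" using W unfolding A_def by auto
      then have "V \<inter> closure (A i) = {}"
        using open_Int_closure_eq_empty[OF UV(2), of "A i"] UV(5) by blast
      then show False using UV(4) y by blast
    qed
  next
    fix y assume "y \<in> {x}"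
    then show "y \<in> (\<Inter>n. closure (A n))"
      using fN closure_subset[of "A n" for n] by (auto simp: A_def N_def)
  qed
  moreover have "(\<lambda>n. measure M (closure (A n))) \<longlonglongrightarrow> measure M (\<Inter>n. closure (A n))"
    by (rule finite_Lim_measure_decseq)
      (auto simp: assms(2) A_def decseq_def intro!: closure_mono)
  ultimately have "(\<lambda>n. measure M (closure (A n))) \<longlonglongrightarrow> 0"
    using assms(4) by (simp add: without_atoms_def measure_def)
  then have "eventually (\<lambda>n. measure M (closure (A n)) < e) sequentially"
    using assms(5) by (rule order_tendstoD)
  then obtain n where "measure M (closure (A n)) < e" by (auto simp: eventually_sequentially)
  moreover have "open (A n)" unfolding A_def
    using fN topological_basis_open[OF B(2)] unfolding N_def by (intro open_INT) auto
  moreover have "x \<in> A n" using fN unfolding A_def N_def by auto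
  ultimately show ?thesis using that by blast
qed

text \<open>Countable subadditivity, applied below to a cover by closures of small open sets and to
  the cover by compact sets.\<close>

lemma (in finite_measure) ex_pos_measure_Int:
  assumes "countable \<D>" "\<D> \<subseteq> sets M" "L \<subseteq> \<Union>\<D>" "L \<in> sets M" "measure M L > 0"
  shows "\<exists>D\<in>\<D>. measure M (L \<inter> D) > 0"
proof (rule ccontr)
  assume neg: "\<not> ?thesis"
  have 0: "L \<inter> D \<in> null_sets M" if "D \<in> \<D>" for D
  proof -
    have "measure M (L \<inter> D) = 0"
      using neg that measure_nonneg[of M "L \<inter> D"] by (metis less_eq_real_def)
    then show ?thesis using that assms(2,4) by (auto simp: null_sets_def emeasure_eq_measure)
  qed
  have "(\<Union>D\<in>\<D>. L \<inter> D) \<in> null_sets M"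
    using assms(1) 0 by (rule null_sets_UN')
  moreover have "(\<Union>D\<in>\<D>. L \<inter> D) = L" using assms(3) by blast
  ultimately show False using \<open>measure M L > 0\<close> by (simp add: measure_def null_setsD1)
qed

text \<open>Neighbourhoods with small closures cover the space; countably many suffice, and their
  closures cannot all meet \<open>L\<close> in a null set. This yields measures that are small yet
  nonzero, as the final contradiction needs.\<close>

lemma small_closed_subset:
  fixes M :: "'a::t2_space measure" and e :: real
  assumes sc: "second_countable (euclidean :: 'a topology)"
    and M: "sets M = sets borel" "finite_measure M" "without_atoms M"
    and "e > 0" "closed L" "measure M L > 0"
  obtains D where "closed D" "measure M (L \<inter> D) > 0" "measure M (L \<inter> D) < e"
proof -
  interpret finite_measure M by fact
  have "\<exists>U. open U \<and> x \<in> U \<and> measure M (closure U) < e" for x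
    using small_neighbourhood[OF sc M \<open>e > 0\<close>, of x] by blast
  then obtain U where U: "\<And>x. open (U x)" "\<And>x. x \<in> U x" "\<And>x. measure M (closure (U x)) < e"
    by metis
  have "\<Union>(range U) = UNIV" using U(2) by blast
  then obtain \<V> where \<V>: "countable \<V>" "\<V> \<subseteq> range U" "\<Union>\<V> = UNIV"
    using Lindelof_spaceD[OF second_countable_imp_Lindelof_space[OF sc], of "range U"] U(1)
    by auto
  have "\<exists>D\<in>closure ` \<V>. measure M (L \<inter> D) > 0"
  proof (rule ex_pos_measure_Int)
    have "\<Union>\<V> \<subseteq> \<Union>(closure ` \<V>)" using closure_subset by fast
    then show "L \<subseteq> \<Union>(closure ` \<V>)" using \<V>(3) by blast
    show "closure ` \<V> \<subseteq> sets M" unfolding M(1) by auto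
    show "L \<in> sets M" unfolding M(1) using \<open>closed L\<close> by (rule borel_closed)
  qed (simp_all add: \<V>(1) \<open>measure M L > 0\<close>)
  then obtain x where x: "measure M (L \<inter> closure (U x)) > 0" using \<V>(2) by auto
  have "measure M (L \<inter> closure (U x)) \<le> measure M (closure (U x))"
    using M(1) by (intro finite_measure_mono) auto
  then show ?thesis using that[of "closure (U x)"] x U(3)[of x] by auto
qed

text \<open>Sigma-compactness takes the place of inner regularity: some \<open>K\<close> of the
  cover meets \<open>L\<close> in positive measure, and \<open>L \<inter> K\<close> is
  compact.\<close>

lemma compact_subset_pos_measure:
  fixes M :: "'a::t2_space measure"
  assumes "countable \<K>" "\<And>K. K \<in> \<K> \<Longrightarrow> compact K" "\<Union>\<K> = (UNIV :: 'a set)"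
    and "sets M = sets borel" "finite_measure M" "closed L" "measure M L > 0"
  obtains K where "compact K" "K \<subseteq> L" "measure M K > 0"
proof -
  interpret finite_measure M by fact
  have "\<exists>K\<in>\<K>. measure M (L \<inter> K) > 0"
    using assms(1,3,4,6,7) borel_closed[OF compact_imp_closed[OF assms(2)]]
    by (intro ex_pos_measure_Int) auto
  then obtain K where "K \<in> \<K>" "measure M (L \<inter> K) > 0" by blast
  then show ?thesis using that[of "L \<inter> K"] closed_Int_compact[OF \<open>closed L\<close> assms(2)] by auto
qed

section \<open>Sums of measures, product integrals and transforms of indicators\<close>

lemma
  assumes "sets N = sets M"
  shows sets_sum_measure[simp]: "sets (sum_measure M N) = sets M"
    and space_sum_measure[simp]: "space (sum_measure M N) = space M"
    and emeasure_sum_measure: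
      "A \<in> sets M \<Longrightarrow> emeasure (sum_measure M N) A = emeasure M A + emeasure N A"
proof -
  show "sets (sum_measure M N) = sets M" "space (sum_measure M N) = space M"
    by (simp_all add: sum_measure_def)
  have "countably_additive (sets M) (\<lambda>A. emeasure M A + emeasure N A)"
    unfolding countably_additive_def
    using assms by (auto simp: suminf_add[symmetric] suminf_emeasure)
  then show "A \<in> sets M \<Longrightarrow> emeasure (sum_measure M N) A = emeasure M A + emeasure N A"
    unfolding sum_measure_def
    by (intro emeasure_measure_of_sigma) (auto simp: sets.sigma_algebra_axioms positive_def)
qed

lemma sum_measure_commute:
  assumes "sets N = sets M"
  shows "sum_measure N M = sum_measure M N"
  by (rule measure_eqI) (auto simp: assms emeasure_sum_measure add.commute)

text \<open>As \<open>N\<close> vanishes on \<open>F\<close>, cutting \<open>sum_measure M N\<close>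
  and \<open>M\<close> down to \<open>F\<close> by a density gives the same measure, hence the same
  integrals.\<close>

lemma integral_sum_measure_indicator:
  fixes f :: "'a \<Rightarrow> 'b::{banach, second_countable_topology}"
  assumes "sets N = sets M" "F \<in> sets M" "emeasure N F = 0" "f \<in> borel_measurable M"
  shows "(\<integral>x. indicator F x *\<^sub>R f x \<partial>sum_measure M N) = (\<integral>x. indicator F x *\<^sub>R f x \<partial>M)"
proof -
  have "density (sum_measure M N) (indicator F) = density M (indicator F)"
  proof (rule measure_eqI)
    fix A assume "A \<in> sets (density (sum_measure M N) (indicator F))"
    then have A: "A \<in> sets M" using assms(1) by simp
    have "emeasure N (F \<inter> A) = 0"
      using assms A by (intro emeasure_eq_0[OF _ assms(3)]) auto
    moreover have "emeasure (density K (indicator F)) A = emeasure K (F \<inter> A)" if "sets K = sets M" for K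
      using A assms(2) that emeasure_density[of "indicator F" K A]
        nn_integral_indicator[of "F \<inter> A" K] by (simp add: indicator_inter_arith)
    ultimately show "emeasure (density (sum_measure M N) (indicator F)) A
        = emeasure (density M (indicator F)) A"
      using A assms by (simp add: emeasure_sum_measure)
  qed (simp add: assms)
  then have "density (sum_measure M N) (\<lambda>x. ennreal (indicator F x)) = density M (\<lambda>x. ennreal (indicator F x))"
    by (simp add: ennreal_indicator)
  moreover have "f \<in> borel_measurable (sum_measure M N)"
    using assms(1,4) by (simp cong: measurable_cong_sets)
  moreover have "indicat_real F \<in> borel_measurable (sum_measure M N)"
    using assms(1,2) by (intro borel_measurable_indicator) simp
  ultimately show ?thesis
    using assms by (subst (1 2) integral_density[symmetric]) auto
qed

text \<open>Fubini; the bounds by 1 make the product integrable, the product measure being a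
  probability.\<close>

lemma (in pair_prob_space) integral_pair_mult:
  fixes f :: "'a \<Rightarrow> complex" and h :: "'b \<Rightarrow> complex"
  assumes [measurable]: "f \<in> borel_measurable M1" "h \<in> borel_measurable M2"
    and "\<And>x. cmod (f x) \<le> 1" "\<And>y. cmod (h y) \<le> 1"
  shows "(\<integral>z. f (fst z) * h (snd z) \<partial>(M1 \<Otimes>\<^sub>M M2)) = (\<integral>x. f x \<partial>M1) * (\<integral>y. h y \<partial>M2)"
proof -
  have "integrable (M1 \<Otimes>\<^sub>M M2) (\<lambda>z. f (fst z) * h (snd z))"
    using assms(3,4) by (intro P.integrable_const_bound[where B = 1])
      (auto simp: norm_mult intro!: mult_le_one)
  then have "(\<integral>x. \<integral>y. f x * h y \<partial>M2 \<partial>M1) = (\<integral>z. f (fst z) * h (snd z) \<partial>(M1 \<Otimes>\<^sub>M M2))"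
    by (subst integral_fst'[symmetric]) auto
  then show ?thesis by simp
qed

lemma dual_groupD:
  assumes "\<gamma> \<in> dual_group"
  shows "cmod (\<gamma> x) = 1" "\<gamma> (x + y) = \<gamma> x * \<gamma> y" "\<gamma> \<in> borel_measurable borel"
  using assms by (auto simp: dual_group_def intro: borel_measurable_continuous_onI)

lemma measurable_cnj[measurable]: "cnj \<in> borel_measurable borel"
  by (intro borel_measurable_continuous_onI continuous_intros)

lemma norm_fourier_indicator_le:
  assumes "finite_measure M" "E \<in> sets M" "\<gamma> \<in> dual_group"
  shows "cmod (fourier M (indicator E) \<gamma>) \<le> measure M E"
proof -
  interpret finite_measure M by fact
  have eq: "cmod (indicator E x * cnj (\<gamma> x)) = indicator E x" for x
    by (simp add: norm_mult dual_groupD(1)[OF assms(3)] indicator_def)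
  have "cmod (fourier M (indicator E) \<gamma>) \<le> (\<integral>x. cmod (indicator E x * cnj (\<gamma> x)) \<partial>M)"
    unfolding fourier_def by (rule integral_norm_bound)
  also have "\<dots> = measure M E" unfolding eq using assms(2) by simp
  finally show ?thesis .
qed

lemma
  fixes p :: real
  assumes "finite_measure M" "F \<in> sets M"
  shows indicator_in_Lp_space: "indicator F \<in> Lp_space p M"
    and Lp_norm_indicator: "Lp_norm p M (indicator F) = measure M F powr (1 / p)"
proof -
  interpret finite_measure M by fact
  \<comment> \<open>\<open>0 powr p\<close> is 0 for every \<open>p\<close>, so an indicator equals
    its own power.\<close>
  have eq: "cmod (indicator F x) powr p = indicator F x" for x by (simp add: indicator_def)
  show "indicator F \<in> Lp_space p M" "Lp_norm p M (indicator F) = measure M F powr (1 / p)"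
    using assms(2) by (simp_all add: Lp_space_def Lp_norm_def eq integrable_indicator_iff
      less_top[symmetric])
qed

section \<open>The measures \<sigma>, \<tau> and \<rho> of a packing pair\<close>

locale packing_pair_space =
  fixes \<mu> lam :: "'a::{topological_ab_group_add, t2_space} measure" and g :: 'a
  assumes second_countable: "second_countable (euclidean :: 'a topology)"
    and sets_\<mu>: "sets \<mu> = sets borel" and prob_\<mu>: "prob_space \<mu>"
    and sets_lam: "sets lam = sets borel" and prob_lam: "prob_space lam"
    and atomless_lam: "without_atoms lam"
    and packing: "packing_pair \<mu> lam"
begin

sublocale \<mu>: prob_space \<mu> by (rule prob_\<mu>)
sublocale lam: prob_space lam by (rule prob_lam)
sublocale pair_prob_space \<mu> lam ..

abbreviation "\<sigma> \<equiv> conv_measure \<mu> lam"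
abbreviation "\<tau> \<equiv> conv_measure (return borel g) \<mu>"
abbreviation "\<rho> \<equiv> sum_measure \<sigma> \<tau>"
abbreviation "K\<^sub>1 \<equiv> closed_support \<mu>"
abbreviation "K\<^sub>2 \<equiv> closed_support lam"

declare sets_\<mu>[measurable_cong] sets_lam[measurable_cong]

lemma space_eq_UNIV[simp]: "space \<mu> = UNIV" "space lam = UNIV"
  using sets_eq_imp_space_eq[OF sets_\<mu>] sets_eq_imp_space_eq[OF sets_lam] by simp_all

lemma sets_conv[simp, measurable_cong]: "sets \<sigma> = sets borel" "sets \<tau> = sets borel"
  by (simp_all add: conv_measure_def)

lemma sets_\<rho>[simp, measurable_cong]: "sets \<rho> = sets borel"
  by simp

lemmas closed_supp = closed_closed_support[OF second_countable sets_\<mu> \<mu>.finite_measure_axioms]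
  closed_closed_support[OF second_countable sets_lam lam.finite_measure_axioms]

lemma measurable_add'[measurable]:
  "(\<lambda>(x, y). x + y) \<in> (borel \<Otimes>\<^sub>M borel) \<rightarrow>\<^sub>M (borel :: 'a measure)"
  unfolding case_prod_beta
  by (rule measurable_pair_continuous[OF second_countable second_countable])
    (intro continuous_intros)

lemma measurable_translate[measurable]:
  "(+) g \<in> borel \<rightarrow>\<^sub>M borel" "(\<lambda>x. x - g) \<in> borel \<rightarrow>\<^sub>M borel"
  by (rule borel_measurable_continuous_onI; intro continuous_intros)+

lemma \<sigma>_eq: "\<sigma> = distr (\<mu> \<Otimes>\<^sub>M lam) borel (\<lambda>(x, y). x + y)"
  by (simp add: conv_measure_def)

lemma measurable_add_pair[measurable]: "(\<lambda>(x, y). x + y) \<in> (\<mu> \<Otimes>\<^sub>M lam) \<rightarrow>\<^sub>M borel"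
  by measurable

text \<open>Integrating the measures of sections against a point mass leaves the section over
  \<open>g\<close>, which is the preimage of \<open>A\<close> under translation.\<close>

lemma \<tau>_eq: "\<tau> = distr \<mu> borel ((+) g)"
proof (rule measure_eqI)
  fix A assume "A \<in> sets \<tau>"
  then have A[measurable]: "A \<in> sets borel" by simp
  let ?Q = "(\<lambda>(x, y). x + y) -` A \<inter> space (return borel g \<Otimes>\<^sub>M \<mu>)"
  have m: "(\<lambda>(x, y). x + y) \<in> (return borel g \<Otimes>\<^sub>M \<mu>) \<rightarrow>\<^sub>M borel"
    using measurable_add'
    unfolding measurable_cong_sets[OF sets_pair_measure_cong[OF sets_return sets_\<mu>] refl] .
  have Q[measurable]: "?Q \<in> sets (return borel g \<Otimes>\<^sub>M \<mu>)" using m A by (rule measurable_sets)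
  have "emeasure \<tau> A = (\<integral>\<^sup>+x. emeasure \<mu> (Pair x -` ?Q) \<partial>return borel g)"
    unfolding conv_measure_def using m by (simp add: emeasure_distr \<mu>.emeasure_pair_measure_alt[OF Q])
  also have "\<dots> = emeasure \<mu> (Pair g -` ?Q)"
    using \<mu>.measurable_emeasure_Pair[OF Q] by (intro nn_integral_return) auto
  also have "Pair g -` ?Q = (+) g -` A \<inter> space \<mu>" by (auto simp: space_pair_measure)
  also have "emeasure \<mu> \<dots> = emeasure (distr \<mu> borel ((+) g)) A" by (subst emeasure_distr) auto
  finally show "emeasure \<tau> A = emeasure (distr \<mu> borel ((+) g)) A" .
qed simp

text \<open>This is \<open>g + C\<close>, written as a preimage so that it inherits measurability
  from subtraction of \<open>g\<close>.\<close>

definition translate :: "'a set \<Rightarrow> 'a set" where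
  "translate C = (\<lambda>x. x - g) -` C"

lemma translate_borel: "C \<in> sets borel \<Longrightarrow> translate C \<in> sets borel"
  unfolding translate_def using measurable_sets[OF measurable_translate(2), of C] by simp

abbreviation "T \<equiv> translate K\<^sub>1"

lemma T_borel[measurable]: "T \<in> sets borel"
  by (rule translate_borel[OF borel_closed[OF closed_supp(1)]])

text \<open>The last hypothesis rearranges \<open>x + y = x' + y'\<close>. The common difference
  lies in both difference sets, so it is 0: sums over the two supports decompose uniquely.\<close>

lemma packingD:
  assumes "x \<in> K\<^sub>1" "x' \<in> K\<^sub>1" "y \<in> K\<^sub>2" "y' \<in> K\<^sub>2" "x - x' = y' - y"
  shows "x = x'" "y = y'"
proof -
  have "x - x' \<in> difference_set K\<^sub>1" "y' - y \<in> difference_set K\<^sub>2"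
    using assms(1-4) unfolding difference_set_def by blast+
  then have "x - x' \<in> difference_set K\<^sub>1 \<inter> difference_set K\<^sub>2" by (simp add: assms(5))
  then have "x - x' = 0" by (simp add: packing[unfolded packing_pair_def])
  with assms(5) show "x = x'" "y = y'" by simp_all
qed

text \<open>For fixed \<open>x\<close>, packing leaves at most one \<open>y \<in> K\<^sub>2\<close> with \<open>x + y \<in> g + K\<^sub>1\<close>, and
  single points are \<^term>\<open>lam\<close>-null.\<close>

lemma \<sigma>_T: "emeasure \<sigma> T = 0"
proof -
  let ?Q = "(\<lambda>(x, y). x + y) -` T \<inter> space (\<mu> \<Otimes>\<^sub>M lam)"
  have Q: "?Q \<in> sets (\<mu> \<Otimes>\<^sub>M lam)" using measurable_add_pair T_borel by (rule measurable_sets)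
  have "emeasure lam (Pair x -` ?Q) = 0" for x
  proof -
    have "AE y in lam. y \<notin> Pair x -` ?Q"
    proof (cases "\<exists>y0 \<in> K\<^sub>2. x + y0 \<in> T")
      case True
      then obtain y0 where y0: "y0 \<in> K\<^sub>2" "x + y0 \<in> T" by blast
      have "{y0} \<in> null_sets lam" using atomless_lam by (simp add: null_sets_def without_atoms_def sets_lam)
      from AE_not_in[OF this] AE_closed_support[OF second_countable sets_lam lam.finite_measure_axioms]
      show ?thesis
      proof eventually_elim
        case (elim y)
        have "y = y0" if "x + y \<in> T"
          using packingD(2)[of "x + y - g" "x + y0 - g" y0 y] that y0 elim(2) by (simp add: translate_def)
        with elim show ?case by auto
      qed
    next
      case False
      from AE_closed_support[OF second_countable sets_lam lam.finite_measure_axioms]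
      show ?thesis by eventually_elim (use False in auto)
    qed
    moreover have "Pair x -` ?Q \<in> sets lam" using Q by (rule sets_Pair1)
    ultimately show ?thesis using AE_iff_null_sets by blast
  qed
  then have "emeasure (\<mu> \<Otimes>\<^sub>M lam) ?Q = 0" by (simp add: lam.emeasure_pair_measure_alt[OF Q])
  then show ?thesis by (simp add: \<sigma>_eq emeasure_distr)
qed

text \<open>The sumset \<open>C + E\<close> without \<open>T\<close>, which carries \<tau>: the
  removal makes the set \<tau>-null, and by \<open>\<sigma>_T\<close> it costs \<sigma>
  nothing.\<close>

definition reduced_sumset :: "'a set \<Rightarrow> 'a set \<Rightarrow> 'a set" where
  "reduced_sumset C E = (\<lambda>(x, y). x + y) ` (C \<times> E) - T"

text \<open>Compactness of \<open>C\<close> and \<open>E\<close> makes their sum a continuous image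
  of a compact product, hence compact and Borel.\<close>

lemma reduced_sumset_borel:
  assumes "compact C" "compact E"
  shows "reduced_sumset C E \<in> sets borel"
proof -
  have "compact ((\<lambda>(x, y). x + y) ` (C \<times> E))"
    unfolding case_prod_beta using assms
    by (intro compact_continuous_image compact_Times continuous_intros)
  then show ?thesis unfolding reduced_sumset_def by (intro sets.Diff borel_compact T_borel)
qed

text \<open>Almost every pair lies in the product of the supports and has its sum outside
  \<open>T\<close>. There unique decomposition shows that a sum in \<open>C + E\<close> can only
  come from \<open>C \<times> E\<close>.\<close>

lemma AE_reduced_sumset:
  assumes C: "compact C" "C \<subseteq> K\<^sub>1" and E: "compact E" "E \<subseteq> K\<^sub>2"
  shows "AE z in \<mu> \<Otimes>\<^sub>M lam. fst z + snd z \<in> reduced_sumset C E \<longleftrightarrow> z \<in> C \<times> E"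
proof -
  have "T \<in> null_sets \<sigma>" using \<sigma>_T by (simp add: null_sets_def T_borel)
  from AE_not_in[OF this] have 1: "AE z in \<mu> \<Otimes>\<^sub>M lam. fst z + snd z \<notin> T"
    unfolding \<sigma>_eq by (subst (asm) AE_distr_iff) (auto simp: case_prod_beta)
  have [measurable]: "K\<^sub>1 \<in> sets borel" "K\<^sub>2 \<in> sets borel" using closed_supp by auto
  have 2: "AE z in \<mu> \<Otimes>\<^sub>M lam. fst z \<in> K\<^sub>1 \<and> snd z \<in> K\<^sub>2"
  proof (rule AE_pair_measure)
    show "AE x in \<mu>. AE y in lam. fst (x, y) \<in> K\<^sub>1 \<and> snd (x, y) \<in> K\<^sub>2"
      using AE_closed_support[OF second_countable sets_\<mu> \<mu>.finite_measure_axioms]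
        AE_closed_support[OF second_countable sets_lam lam.finite_measure_axioms]
      by auto
  qed measurable
  from 1 2 show ?thesis
  proof eventually_elim
    case (elim z)
    have "z \<in> C \<times> E" if "fst z + snd z \<in> reduced_sumset C E"
    proof -
      obtain c e where ce: "c \<in> C" "e \<in> E" "fst z + snd z = c + e"
        using \<open>fst z + snd z \<in> reduced_sumset C E\<close> by (auto simp: reduced_sumset_def)
      then have "fst z - c = e - snd z" by (simp add: algebra_simps)
      moreover have "c \<in> K\<^sub>1" "e \<in> K\<^sub>2" using ce C(2) E(2) by auto
      ultimately have "fst z = c" "snd z = e" using packingD[of "fst z" c "snd z" e] elim(2) by auto
      with ce show ?thesis by (simp add: mem_Times_iff)
    qed
    moreover have "fst z + snd z \<in> reduced_sumset C E" if "z \<in> C \<times> E"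
      using that elim(1) by (force simp: reduced_sumset_def)
    ultimately show ?case by blast
  qed
qed

lemma \<tau>_reduced_sumset:
  assumes "compact C" "compact E"
  shows "emeasure \<tau> (reduced_sumset C E) = 0"
proof -
  have "AE x in \<mu>. g + x \<notin> reduced_sumset C E"
    using AE_closed_support[OF second_countable sets_\<mu> \<mu>.finite_measure_axioms]
    by eventually_elim (auto simp: reduced_sumset_def translate_def)
  then have "AE x in \<tau>. x \<notin> reduced_sumset C E"
    unfolding \<tau>_eq using reduced_sumset_borel[OF assms] by (subst AE_distr_iff) auto
  moreover have "reduced_sumset C E \<in> sets \<tau>" using reduced_sumset_borel[OF assms] by simp
  ultimately show ?thesis using AE_iff_null_sets by blast
qed

lemma \<sigma>_translate:
  assumes "C \<subseteq> K\<^sub>1"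
  shows "emeasure \<sigma> (translate C) = 0"
  using assms by (intro emeasure_eq_0[OF _ \<sigma>_T]) (auto simp: translate_def T_borel[unfolded translate_def])

lemma finite_measure_\<rho>: "finite_measure \<rho>"
proof
  have "prob_space \<sigma>" "prob_space \<tau>"
    unfolding \<sigma>_eq \<tau>_eq by (intro prob_space_distr \<mu>.prob_space_distr; measurable)+
  then show "emeasure \<rho> (space \<rho>) \<noteq> \<infinity>"
    using prob_space.emeasure_space_1[of \<sigma>] prob_space.emeasure_space_1[of \<tau>]
      sets_eq_imp_space_eq[of \<tau> \<sigma>]
    by (simp add: emeasure_sum_measure[OF _ sets.top])
qed

text \<open>Only \<sigma> charges the reduced sumset, and addition pulls it back to the rectangle
  \<open>C \<times> E\<close> up to a null set.\<close>

lemma measure_reduced_sumset: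
  assumes C: "compact C" "C \<subseteq> K\<^sub>1" and E: "compact E" "E \<subseteq> K\<^sub>2"
  shows "measure \<rho> (reduced_sumset C E) = measure \<mu> C * measure lam E"
proof -
  have [measurable]: "reduced_sumset C E \<in> sets borel" using reduced_sumset_borel C E by blast
  have [measurable]: "C \<in> sets borel" "E \<in> sets borel" using C(1) E(1) by (auto intro: borel_compact)
  have "emeasure \<rho> (reduced_sumset C E) = emeasure \<sigma> (reduced_sumset C E)"
    using \<tau>_reduced_sumset C E by (simp add: emeasure_sum_measure)
  also have "\<dots> = emeasure (\<mu> \<Otimes>\<^sub>M lam) ((\<lambda>(x, y). x + y) -` reduced_sumset C E \<inter> space (\<mu> \<Otimes>\<^sub>M lam))"
    unfolding \<sigma>_eq by (rule emeasure_distr) measurable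
  also have "\<dots> = emeasure (\<mu> \<Otimes>\<^sub>M lam) (C \<times> E)"
    using AE_reduced_sumset[OF assms]
    by (intro emeasure_eq_AE measurable_sets[OF measurable_add_pair])
      (auto simp: case_prod_beta space_pair_measure)
  also have "\<dots> = emeasure \<mu> C * emeasure lam E" by (rule lam.emeasure_pair_measure_Times) measurable
  finally show ?thesis by (simp add: measure_def enn2real_mult)
qed

text \<open>\<open>translate C\<close> lies in \<open>T\<close>, which is \<sigma>-null, so only
  \<tau> is seen, and \<tau> is \<mu> translated by \<open>g\<close>.\<close>

lemma measure_translate:
  assumes "C \<in> sets borel" "C \<subseteq> K\<^sub>1"
  shows "measure \<rho> (translate C) = measure \<mu> C"
proof -
  have "emeasure \<rho> (translate C) = emeasure \<tau> (translate C)"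
    using \<sigma>_translate translate_borel assms by (simp add: emeasure_sum_measure)
  also have "\<dots> = emeasure \<mu> ((+) g -` translate C \<inter> space \<mu>)"
    unfolding \<tau>_eq using translate_borel[OF assms(1)] by (intro emeasure_distr) auto
  also have "(+) g -` translate C \<inter> space \<mu> = C" by (auto simp: translate_def)
  finally show ?thesis by (simp add: measure_def)
qed

text \<open>The integral over \<rho> reduces to \<sigma>, then to the rectangle
  \<open>C \<times> E\<close> in the product; there the character is multiplicative and Fubini
  separates the factors.\<close>

lemma fourier_reduced_sumset:
  assumes C: "compact C" "C \<subseteq> K\<^sub>1" and E: "compact E" "E \<subseteq> K\<^sub>2" and \<gamma>: "\<gamma> \<in> dual_group"
  shows "fourier \<rho> (indicator (reduced_sumset C E)) \<gamma> =
    fourier \<mu> (indicator C) \<gamma> * fourier lam (indicator E) \<gamma>"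
proof -
  let ?F = "reduced_sumset C E"
  have [measurable]: "?F \<in> sets borel" using reduced_sumset_borel C E by blast
  have [measurable]: "C \<in> sets borel" "E \<in> sets borel" using C(1) E(1) by (auto intro: borel_compact)
  note [measurable] = dual_groupD(3)[OF \<gamma>]
  have ind: "indicator S x * cnj (\<gamma> x) = indicator S x *\<^sub>R cnj (\<gamma> x)" for S x
    by (simp add: indicator_def)
  have "fourier \<rho> (indicator ?F) \<gamma> = (\<integral>x. indicator ?F x *\<^sub>R cnj (\<gamma> x) \<partial>\<sigma>)"
    unfolding fourier_def ind using \<tau>_reduced_sumset[OF C(1) E(1)]
    by (intro integral_sum_measure_indicator) (simp, simp, simp, measurable)
  also have "\<dots> = (\<integral>z. indicator ?F (fst z + snd z) *\<^sub>R cnj (\<gamma> (fst z + snd z)) \<partial>(\<mu> \<Otimes>\<^sub>M lam))"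
    unfolding \<sigma>_eq by (subst integral_distr) (auto simp: case_prod_beta)
  also have "\<dots> = (\<integral>z. (indicator C (fst z) * cnj (\<gamma> (fst z))) * (indicator E (snd z) * cnj (\<gamma> (snd z))) \<partial>(\<mu> \<Otimes>\<^sub>M lam))"
  proof (rule integral_cong_AE)
    have [measurable]: "(\<lambda>z. fst z + snd z) \<in> (\<mu> \<Otimes>\<^sub>M lam) \<rightarrow>\<^sub>M borel"
      using measurable_add_pair by (simp add: case_prod_beta)
    show "(\<lambda>z. indicator ?F (fst z + snd z) *\<^sub>R cnj (\<gamma> (fst z + snd z))) \<in> borel_measurable (\<mu> \<Otimes>\<^sub>M lam)"
      by measurable
    show "AE z in \<mu> \<Otimes>\<^sub>M lam. indicator ?F (fst z + snd z) *\<^sub>R cnj (\<gamma> (fst z + snd z)) =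
      (indicator C (fst z) * cnj (\<gamma> (fst z))) * (indicator E (snd z) * cnj (\<gamma> (snd z)))"
      using AE_reduced_sumset[OF C E]
      by eventually_elim (auto simp: indicator_def mem_Times_iff dual_groupD(2)[OF \<gamma>])
  qed measurable
  also have "\<dots> = fourier \<mu> (indicator C) \<gamma> * fourier lam (indicator E) \<gamma>"
    unfolding fourier_def
    by (rule integral_pair_mult) (auto simp: norm_mult dual_groupD(1)[OF \<gamma>] indicator_def)
  finally show ?thesis .
qed

text \<open>Undoing the translation only brings in the factor \<open>cnj (\<gamma> g)\<close>, of
  modulus 1.\<close>

lemma norm_fourier_translate:
  assumes C: "C \<in> sets borel" "C \<subseteq> K\<^sub>1" and \<gamma>: "\<gamma> \<in> dual_group"
  shows "cmod (fourier \<rho> (indicator (translate C)) \<gamma>) = cmod (fourier \<mu> (indicator C) \<gamma>)"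
proof -
  let ?F = "translate C"
  have [measurable]: "?F \<in> sets borel" using translate_borel C by blast
  note [measurable] = dual_groupD(3)[OF \<gamma>]
  have ind: "indicator S x * cnj (\<gamma> x) = indicator S x *\<^sub>R cnj (\<gamma> x)" for S x
    by (simp add: indicator_def)
  \<comment> \<open>The sum is commuted so that \<tau> comes first and \<sigma> is the summand
    vanishing on the set.\<close>
  have "fourier \<rho> (indicator ?F) \<gamma> = (\<integral>x. indicator ?F x *\<^sub>R cnj (\<gamma> x) \<partial>\<tau>)"
    unfolding fourier_def ind sum_measure_commute[of \<sigma> \<tau>, simplified]
    using \<sigma>_translate[OF C(2)]
    by (intro integral_sum_measure_indicator) (simp, simp, simp, measurable)
  also have "\<dots> = (\<integral>x. indicator ?F (g + x) *\<^sub>R cnj (\<gamma> (g + x)) \<partial>\<mu>)"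
    unfolding \<tau>_eq by (subst integral_distr) auto
  also have "\<dots> = (\<integral>x. cnj (\<gamma> g) * (indicator C x * cnj (\<gamma> x)) \<partial>\<mu>)"
    by (intro Bochner_Integration.integral_cong)
      (auto simp: dual_groupD(2)[OF \<gamma>] translate_def indicator_def)
  also have "\<dots> = cnj (\<gamma> g) * fourier \<mu> (indicator C) \<gamma>" by (simp add: fourier_def)
  finally show ?thesis by (simp add: norm_mult dual_groupD(1)[OF \<gamma>])
qed

section \<open>The frame inequalities for the test functions\<close>

text \<open>\<open>r\<close> is \<open>A / B\<close>, one constant for all \<open>C\<close> and
  \<open>E\<close>. The measure of \<open>C\<close> occurs with the same exponent on both sides and,
  being positive, cancels.\<close>

lemma frame_bound_ratio:
  assumes "frame_measure p q \<rho> \<nu>" "1 < q"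
  obtains r where "r > 0"
    "\<And>C E. compact C \<Longrightarrow> C \<subseteq> K\<^sub>1 \<Longrightarrow> measure \<mu> C > 0 \<Longrightarrow> compact E \<Longrightarrow> E \<subseteq> K\<^sub>2 \<Longrightarrow>
      measure lam E > 0 \<Longrightarrow> r \<le> measure lam E powr (q - q / p)"
proof -
  from assms(1) obtain A B where AB: "0 < A" "A \<le> B" "sets \<nu> = sets dual_borel"
    and frame: "\<And>f. f \<in> Lp_space p \<rho> \<Longrightarrow> fourier \<rho> f \<in> Lp_space q \<nu> \<and>
      A * Lp_norm p \<rho> f powr q \<le> Lp_norm q \<nu> (fourier \<rho> f) powr q \<and>
      Lp_norm q \<nu> (fourier \<rho> f) powr q \<le> B * Lp_norm p \<rho> f powr q"
    unfolding frame_measure_def by auto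
  \<comment> \<open>The comparison of transforms is available for characters, so the integral over
    \<nu> has to range over \<open>dual_group\<close>.\<close>
  have sp: "space \<nu> = dual_group"
    using sets_eq_imp_space_eq[OF AB(3)] by (simp add: dual_borel_def space_measure_of_conv)
  \<comment> \<open>Raising to the power \<open>q\<close> removes the root in
    \<open>Lp_norm\<close>, so the frame bounds become bounds on integrals.\<close>
  have Lq: "Lp_norm q \<nu> F powr q = (\<integral>\<gamma>. cmod (F \<gamma>) powr q \<partial>\<nu>)" for F
    using \<open>1 < q\<close> by (simp add: Lp_norm_def powr_powr)
  have "A / B \<le> l powr (q - q / p)"
    if C: "compact C" "C \<subseteq> K\<^sub>1" "measure \<mu> C > 0" and E: "compact E" "E \<subseteq> K\<^sub>2"
      and l: "l = measure lam E" "l > 0" for C E l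
  proof -
    let ?f = "indicator (reduced_sumset C E)" and ?h = "indicator (translate C)" and ?m = "measure \<mu> C"
    have [measurable]: "C \<in> sets borel" "E \<in> sets borel" using C(1) E(1) by (auto intro: borel_compact)
    have s: "reduced_sumset C E \<in> sets \<rho>" "translate C \<in> sets \<rho>"
      using reduced_sumset_borel C E translate_borel by auto
    note f = frame[OF indicator_in_Lp_space[OF finite_measure_\<rho> s(1)]]
    note h = frame[OF indicator_in_Lp_space[OF finite_measure_\<rho> s(2)]]
    have "A * (?m * l) powr (q / p) = A * Lp_norm p \<rho> ?f powr q"
      using measure_reduced_sumset[OF C(1,2) E] l
      by (simp add: Lp_norm_indicator[OF finite_measure_\<rho> s(1)] powr_powr)
    also have "\<dots> \<le> (\<integral>\<gamma>. cmod (fourier \<rho> ?f \<gamma>) powr q \<partial>\<nu>)"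
      using f unfolding Lq by blast
    also have "\<dots> \<le> (\<integral>\<gamma>. l powr q * cmod (fourier \<rho> ?h \<gamma>) powr q \<partial>\<nu>)"
    proof (rule integral_mono)
      \<comment> \<open>Integrability of both sides comes from the membership clause of
        \<open>frame_measure\<close>. A non-integrable right-hand side would have integral 0 by
        default, and monotonicity could fail.\<close>
      show "integrable \<nu> (\<lambda>\<gamma>. cmod (fourier \<rho> ?f \<gamma>) powr q)"
        using f by (simp add: Lp_space_def)
      show "integrable \<nu> (\<lambda>\<gamma>. l powr q * cmod (fourier \<rho> ?h \<gamma>) powr q)"
        using h by (simp add: Lp_space_def)
      fix \<gamma> assume "\<gamma> \<in> space \<nu>"
      then have \<gamma>: "\<gamma> \<in> dual_group" by (simp add: sp)
      have "cmod (fourier lam (indicator E) \<gamma>) \<le> l"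
        using norm_fourier_indicator_le[OF lam.finite_measure_axioms _ \<gamma>, of E] l
        by (simp add: sets_lam)
      \<comment> \<open>In modulus both transforms contain the factor from \<open>C\<close>; that of
        \<open>?f\<close> has in addition the factor from \<open>E\<close>, at most
        \<open>l\<close>.\<close>
      then have "cmod (fourier \<rho> ?f \<gamma>) \<le> l * cmod (fourier \<rho> ?h \<gamma>)"
        using fourier_reduced_sumset[OF C(1,2) E \<gamma>] norm_fourier_translate[OF _ C(2) \<gamma>]
        by (simp add: norm_mult mult.commute[of l] mult_left_mono)
      then have "cmod (fourier \<rho> ?f \<gamma>) powr q \<le> (l * cmod (fourier \<rho> ?h \<gamma>)) powr q"
        using \<open>1 < q\<close> by (intro powr_mono2) auto
      then show "cmod (fourier \<rho> ?f \<gamma>) powr q \<le> l powr q * cmod (fourier \<rho> ?h \<gamma>) powr q"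
        using l(2) by (simp add: powr_mult)
    qed
    also have "\<dots> = l powr q * Lp_norm q \<nu> (fourier \<rho> ?h) powr q" by (simp add: Lq)
    also have "\<dots> \<le> l powr q * (B * Lp_norm p \<rho> ?h powr q)"
      using h by (intro mult_left_mono) auto
    also have "\<dots> = l powr q * (B * ?m powr (q / p))"
      using measure_translate[OF _ C(2)]
      by (simp add: Lp_norm_indicator[OF finite_measure_\<rho> s(2)] powr_powr)
    finally have "A * l powr (q / p) * ?m powr (q / p) \<le> B * l powr q * ?m powr (q / p)"
      using C(3) l by (simp add: powr_mult mult_ac)
    then have "A * l powr (q / p) \<le> B * l powr q" using C(3) by simp
    then show ?thesis using AB(1,2) l(2) by (simp add: powr_diff field_simps)
  qed
  with AB show ?thesis by (intro that[of "A / B"]) auto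
qed

end

section \<open>Contradiction from sets of small positive measure\<close>

theorem theorem2p18:
  fixes p q :: real
    and \<mu> lam :: "'a::{topological_ab_group_add, t2_space} measure"
    and g :: 'a
  assumes "locally_compact_space (euclidean :: 'a topology)"
    and "metrizable_space (euclidean :: 'a topology)"
    and "\<exists>\<K> :: 'a set set. countable \<K> \<and> (\<forall>K\<in>\<K>. compact K) \<and> \<Union>\<K> = UNIV"
    and "1 < p" and "1 < q"
    and "sets \<mu> = sets borel" and "prob_space \<mu>" and "without_atoms \<mu>"
    and "sets lam = sets borel" and "prob_space lam" and "without_atoms lam"
    and "packing_pair \<mu> lam"
  shows "\<not> admits_frame_measure p q
           (sum_measure (conv_measure \<mu> lam) (conv_measure (return borel g) \<mu>))"
proof
  obtain \<K> :: "'a set set" where \<K>: "countable \<K>" "\<And>K. K \<in> \<K> \<Longrightarrow> compact K" "\<Union>\<K> = UNIV"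
    using assms(3) by blast
  have sc: "second_countable (euclidean :: 'a topology)"
    using metrizable_Lindelof_imp_second_countable[OF assms(2) Lindelof_space_sigma_compact[OF \<K>]] .
  interpret packing_pair_space \<mu> lam g
    by (rule packing_pair_space.intro) (use assms sc in simp_all)
  assume "admits_frame_measure p q \<rho>"
  then obtain \<nu> where "frame_measure p q \<rho> \<nu>" by (auto simp: admits_frame_measure_def)
  from frame_bound_ratio[OF this \<open>1 < q\<close>] obtain r where r: "r > 0"
    "\<And>C E. compact C \<Longrightarrow> C \<subseteq> K\<^sub>1 \<Longrightarrow> measure \<mu> C > 0 \<Longrightarrow> compact E \<Longrightarrow> E \<subseteq> K\<^sub>2 \<Longrightarrow>
      measure lam E > 0 \<Longrightarrow> r \<le> measure lam E powr (q - q / p)" by blast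
  define s where "s = q - q / p"
  \<comment> \<open>\<open>s\<close> equals \<open>q * (1 - 1 / p)\<close>.\<close>
  have "s > 0" unfolding s_def using \<open>1 < p\<close> \<open>1 < q\<close> by (simp add: field_simps)
  have full: "measure \<mu> K\<^sub>1 > 0" "measure lam K\<^sub>2 > 0"
    using AE_closed_support[OF sc sets_\<mu> \<mu>.finite_measure_axioms]
      AE_closed_support[OF sc sets_lam lam.finite_measure_axioms] closed_supp
      \<mu>.prob_eq_1[of K\<^sub>1] lam.prob_eq_1[of K\<^sub>2] by (auto simp: sets_\<mu> sets_lam)
  obtain C where C: "compact C" "C \<subseteq> K\<^sub>1" "measure \<mu> C > 0"
    using compact_subset_pos_measure[OF \<K> sets_\<mu> \<mu>.finite_measure_axioms closed_supp(1) full(1)] .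
  \<comment> \<open>The threshold is the \<open>s\<close>-th root of \<open>r\<close>, so that a
    measure below it has \<open>s\<close>-th power below \<open>r\<close>.\<close>
  have "r powr (1 / s) > 0" using r(1) by simp
  then obtain D where D: "closed D" "measure lam (K\<^sub>2 \<inter> D) > 0" "measure lam (K\<^sub>2 \<inter> D) < r powr (1 / s)"
    using small_closed_subset[OF sc sets_lam lam.finite_measure_axioms atomless_lam _ closed_supp(2) full(2)]
    by blast
  \<comment> \<open>Passing to a compact subset keeps the measure positive, and the upper bound
    carries over by monotonicity.\<close>
  obtain E where E: "compact E" "E \<subseteq> K\<^sub>2 \<inter> D" "measure lam E > 0"
    using compact_subset_pos_measure[OF \<K> sets_lam lam.finite_measure_axioms closed_Int[OF closed_supp(2) D(1)] D(2)] .
  have "measure lam E \<le> measure lam (K\<^sub>2 \<inter> D)"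
    using E(2) closed_supp(2) D(1) by (intro lam.finite_measure_mono) (auto simp: sets_lam)
  then have "measure lam E powr s < (r powr (1 / s)) powr s"
    using D(3) E(3) \<open>s > 0\<close> by (intro powr_less_mono2) auto
  also have "\<dots> = r" using r(1) \<open>s > 0\<close> by (simp add: powr_powr)
  finally show False using r(2)[OF C E(1) _ E(3)] E(2) by (auto simp: s_def)
qed

end
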